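(* In the setting described in the context, let $u(\omega)\in V$ be the solution of $A(\omega;u(\omega),v)=F(\omega;v)$ for all $v\in V$, and let $\{U_n(\omega)\}_{n\ge 0}\subset V$ be the sequence generated by the iterative algorithm. Suppose that $A_0$ is bilinear, bounded with constant $\Lambda_0$ and coercive with constant $\lambda_0$ on $V\times V$, and that there is $\rho\in(0,1)$ such that $$\frac{\|A_1(\omega)\|_{\mathcal{L}(V\times V,\mathbb{R})}}{\lambda_0}<\rho\qquad\text{for all }\omega\in\Omega.$$ Then there exists a constant $C>0$, independent of $\omega\in\Omega$ (and of $n$), such that $$\|u(\omega)-U_n(\omega)\|_V\le C\rho^{n+1}\qquad\text{for all }\omega\in\Omega \text{ and all } n\ge 0.$$ Hence $U_n(\omega)$ converges to $u(\omega)$ strongly in $V$ as $n\to\infty$ for every $\omega\in\Omega$.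
   Context: Let $H$ be a (real) Hilbert space, $V\subset H$ a (real) Banach space, and $V^*$ the dual space of bounded linear functionals on $V$. Let $\Omega$ be a set (the parameter space). For each $\omega\in\Omega$, let $F(\omega;\cdot)\in V^*$ and let $A(\omega;\cdot,\cdot):V\times V\to\mathbb{R}$ be a bilinear form (not necessarily symmetric). Assume there are constants $\Lambda>0$ and $\lambda>0$, independent of $\omega$, such that $|A(\omega;v,w)|\le\Lambda\|v\|_V\|w\|_V$ for all $v,w\in V$ (boundedness) and $A(\omega;v,v)\ge\lambda\|v\|_V^2$ for all $v\in V$ (coercivity). Assume also that there is an $\omega$-independent constant $C_F>0$ with $\|F(\omega)\|_{V^*}\le C_F$ for all $\omega\in\Omega$. By the Lax-Milgram theorem the problem $A(\omega;u,v)=F(\omega;v)$ for all $v\in V$ has a unique solution $u(\omega)\in V$, and $\|u(\omega)\|_V\le\|F(\omega)\|_{V^*}/\lambda$. Let $A_0(\cdot,\cdot):V\times V\to\mathbb{R}$ be an $\omega$-independent bilinear form, and set $A_1(\omega;\cdot,\cdot)=A(\omega;\cdot,\cdot)-A_0(\cdot,\cdot)$. That $A_0$ is bounded with constant $\Lambda_0>0$ and coercive with constant $\lambda_0>0$ means $|A_0(v,w)|\le\Lambda_0\|v\|_V\|w\|_V$ for all $v,w\in V$ and $A_0(v,v)\ge\lambda_0\|v\|_V^2$ for all $v\in V$. The norm of a bounded bilinear form $B$ is $\|B\|_{\mathcal{L}(V\times V,\mathbb{R})}=\sup\{|B(v,w)|:\|v\|_V\le1,\ \|w\|_V\le1\}$.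 Iterative algorithm: for each $\omega\in\Omega$, $U_0=U_0(\omega)\in V$ is defined by $A_0(U_0,v)=F(\omega;v)$ for all $v\in V$, and, for $n\ge1$, $U_n=U_n(\omega)\in V$ is defined recursively by $A_0(U_n,v)=F(\omega;v)-A_1(\omega;U_{n-1},v)$ for all $v\in V$. *)

theory Defs
  imports "HOL-Analysis.Analysis"
begin

definition bounded_form :: "real \<Rightarrow> ('v::real_normed_vector \<Rightarrow> 'v \<Rightarrow> real) \<Rightarrow> bool" where
  "bounded_form L B \<longleftrightarrow> (\<forall>v w. \<bar>B v w\<bar> \<le> L * norm v * norm w)"

definition coercive_form :: "real \<Rightarrow> ('v::real_normed_vector \<Rightarrow> 'v \<Rightarrow> real) \<Rightarrow> bool" where
  "coercive_form l B \<longleftrightarrow> (\<forall>v. B v v \<ge> l * (norm v)\<^sup>2)"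

(* The supremum is taken in the reals, so this is the norm of B only if B is a bounded form;
   the index set contains (0, 0) and is never empty. *)
definition form_norm :: "('v::real_normed_vector \<Rightarrow> 'v \<Rightarrow> real) \<Rightarrow> real" where
  "form_norm B = Sup {\<bar>B v w\<bar> | v w. norm v \<le> 1 \<and> norm w \<le> 1}"

definition form_diff :: "('v \<Rightarrow> 'v \<Rightarrow> real) \<Rightarrow> ('v \<Rightarrow> 'v \<Rightarrow> real) \<Rightarrow> 'v \<Rightarrow> 'v \<Rightarrow> real" where
  "form_diff B B0 v w = B v w - B0 v w"

definition solves :: "('v::real_normed_vector \<Rightarrow> 'v \<Rightarrow> real) \<Rightarrow> ('v \<Rightarrow>\<^sub>L real) \<Rightarrow> 'v \<Rightarrow> bool" where
  "solves B f u \<longleftrightarrow> (\<forall>v. B u v = blinfun_apply f v)"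

(* Here B is the full form A(omega; ., .), B0 is the form A_0, and form_diff B B0 is
   A_1(omega; ., .).  When B0 is bounded and coercive on a Banach space, Lax-Milgram provides
   exactly one such sequence U. *)
definition iterates ::
  "('v::real_normed_vector \<Rightarrow> 'v \<Rightarrow> real) \<Rightarrow> ('v \<Rightarrow> 'v \<Rightarrow> real) \<Rightarrow> ('v \<Rightarrow>\<^sub>L real) \<Rightarrow> (nat \<Rightarrow> 'v) \<Rightarrow> bool"
where
  "iterates B B0 f U \<longleftrightarrow>
     (\<forall>v. B0 (U 0) v = blinfun_apply f v) \<and>
     (\<forall>n\<ge>1. \<forall>v. B0 (U n) v = blinfun_apply f v - form_diff B B0 (U (n - 1)) v)"

end

theory Submission
  imports Defs
begin

text \<open>The solution \<open>u\<close> satisfies \<open>A\<^sub>0(u, v) = F(v) - A\<^sub>1(u, v)\<close>, so the error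
  \<open>e\<^sub>n = u - U\<^sub>n\<close> satisfies \<open>A\<^sub>0(e\<^sub>n, v) = - A\<^sub>1(e\<^sub>n\<^sub>-\<^sub>1, v)\<close>, and this also holds for \<open>n = 0\<close> with
  \<open>e\<^sub>-\<^sub>1 = u\<close>. Testing with \<open>v = e\<^sub>n\<close>, coercivity gives \<open>\<parallel>e\<^sub>n\<parallel> \<le> \<rho> \<parallel>e\<^sub>n\<^sub>-\<^sub>1\<parallel>\<close>, and
  \<open>\<parallel>u\<parallel>\<close> is bounded uniformly by the Lax--Milgram estimate.\<close>

lemma bilinear_form_diff:
  assumes "bilinear B" "bilinear B0"
  shows "bilinear (form_diff B B0)"
proof -
  have "linear (\<lambda>w. B v w - B0 v w)" "linear (\<lambda>v. B v w - B0 v w)" for v w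
    using assms unfolding bilinear_def by (auto intro: linear_compose_sub)
  then show ?thesis
    unfolding bilinear_def form_diff_def by blast
qed

text \<open>Ensures that the supremum in \<open>form_norm\<close> of the difference runs over a set
  bounded above, so that it dominates the values of the form.\<close>

lemma bounded_form_diff:
  assumes "bounded_form L B" "bounded_form L0 B0"
  shows "bounded_form (L + L0) (form_diff B B0)"
  unfolding bounded_form_def
proof (intro allI)
  fix v w
  have "\<bar>B v w\<bar> \<le> L * norm v * norm w" "\<bar>B0 v w\<bar> \<le> L0 * norm v * norm w"
    using assms unfolding bounded_form_def by blast+
  then show "\<bar>form_diff B B0 v w\<bar> \<le> (L + L0) * norm v * norm w"
    unfolding form_diff_def distrib_right by linarith
qed

lemma form_norm_upper:
  assumes "bounded_form L B" "norm v \<le> 1" "norm w \<le> 1"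
  shows "\<bar>B v w\<bar> \<le> form_norm B"
  unfolding form_norm_def
proof (rule cSup_upper)
  show "\<bar>B v w\<bar> \<in> {\<bar>B v w\<bar> |v w. norm v \<le> 1 \<and> norm w \<le> 1}"
    using assms by blast
  \<comment> \<open>A real \<open>Sup\<close> is an upper bound only of a set that is bounded above.
    The sign of \<open>L\<close> is arbitrary, hence its absolute value as the bound.\<close>
  show "bdd_above {\<bar>B v w\<bar> |v w. norm v \<le> 1 \<and> norm w \<le> 1}"
  proof (rule bdd_aboveI[of _ "\<bar>L\<bar>"], safe)
    fix x y :: 'a
    assume xy: "norm x \<le> 1" "norm y \<le> 1"
    have "\<bar>B x y\<bar> \<le> L * (norm x * norm y)"
      using assms(1) by (simp add: bounded_form_def mult.assoc)
    also have "\<dots> \<le> \<bar>L\<bar> * (norm x * norm y)"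
      by (intro mult_right_mono) auto
    also have "\<dots> \<le> \<bar>L\<bar> * 1"
      using xy by (intro mult_left_mono mult_le_one) auto
    finally show "\<bar>B x y\<bar> \<le> \<bar>L\<bar>" by simp
  qed
qed

text \<open>By bilinearity both arguments can be scaled to norm 1, with their norms pulled out as
  factors. A zero argument cannot be normalised, but there both sides vanish.\<close>

lemma form_norm_bound:
  assumes "bilinear B" "bounded_form L B"
  shows "\<bar>B v w\<bar> \<le> form_norm B * norm v * norm w"
proof (cases "v = 0 \<or> w = 0")
  case True
  then show ?thesis
    using assms(1) by (auto simp: bilinear_lzero bilinear_rzero)
next
  case False
  have "B v w = norm v * norm w * B (v /\<^sub>R norm v) (w /\<^sub>R norm w)"
    using False by (simp add: bilinear_lmul[OF assms(1)] bilinear_rmul[OF assms(1)] field_simps)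
  then have "\<bar>B v w\<bar> = norm v * norm w * \<bar>B (v /\<^sub>R norm v) (w /\<^sub>R norm w)\<bar>"
    by (simp add: abs_mult)
  also have "\<dots> \<le> norm v * norm w * form_norm B"
    using False by (intro mult_left_mono form_norm_upper[OF assms(2)]) auto
  finally show ?thesis by (simp add: mult_ac)
qed

text \<open>Coercivity gives \<open>l * norm v * norm v \<le> c * norm v\<close>, and a nonzero
  \<open>norm v\<close> cancels; \<open>c \<ge> 0\<close> settles \<open>v = 0\<close>. Serves both
  the a priori bound on the solution and the contraction step.\<close>

lemma coercive_form_norm_le:
  assumes "coercive_form l B" "l > 0" "c \<ge> 0" "B v v \<le> c * norm v"
  shows "norm v \<le> c / l"
proof (cases "v = 0")
  case False
  have "(l * norm v) * norm v \<le> c * norm v"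
    using assms(1,4) unfolding coercive_form_def power2_eq_square mult.assoc
    by (blast intro: order_trans)
  then show ?thesis
    using False \<open>l > 0\<close> by (simp add: field_simps)
qed (use assms in simp)

text \<open>The equation is tested with \<open>u\<close> itself.\<close>

lemma solves_norm_le:
  assumes "coercive_form l B" "l > 0" "solves B f u"
  shows "norm u \<le> norm f / l"
proof (rule coercive_form_norm_le[OF assms(1,2)])
  show "B u u \<le> norm f * norm u"
    using assms(3) norm_blinfun[of f u] by (simp add: solves_def)
qed simp

text \<open>Here \<open>x\<close> and \<open>y\<close> need not be members of the sequence, so that
  the initial iterate can be treated as a step too.\<close>

lemma iterates_step_contraction:
  assumes B: "bilinear B" "bounded_form L B"
    and B0: "bilinear B0" "bounded_form L0 B0" "coercive_form l0 B0" "l0 > 0"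
    and small: "form_norm (form_diff B B0) / l0 < \<rho>" and "\<rho> > 0"
    and u: "solves B f u"
    and step: "\<And>v. B0 y v = blinfun_apply f v - form_diff B B0 x v"
  shows "norm (u - y) \<le> \<rho> * norm (u - x)"
proof -
  let ?D = "form_diff B B0"
  have D: "bilinear ?D" "bounded_form (L + L0) ?D"
    by (fact bilinear_form_diff[OF B(1) B0(1)] bounded_form_diff[OF B(2) B0(2)])+
  \<comment> \<open>Since \<open>B\<close> is the sum of \<open>B0\<close> and \<open>?D\<close>,
    the solution is a fixed point: \<open>step\<close> holds with \<open>u\<close> in place of both
    \<open>x\<close> and \<open>y\<close>. Subtracting the two equations gives the claim.\<close>
  have err: "B0 (u - y) v = - ?D (u - x) v" for v
    using u step[of v]
    by (simp add: bilinear_lsub[OF B0(1)] bilinear_lsub[OF D(1)])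
      (simp add: solves_def form_diff_def)
  have "B0 (u - y) (u - y) \<le> \<bar>?D (u - x) (u - y)\<bar>"
    unfolding err by simp
  also have "\<dots> \<le> form_norm ?D * norm (u - x) * norm (u - y)"
    by (rule form_norm_bound[OF D])
  \<comment> \<open>Smallness is used as \<open>form_norm ?D < \<rho> * l0\<close>; the factor
    \<open>l0\<close> then cancels against the coercivity constant.\<close>
  also have "\<dots> \<le> (\<rho> * l0 * norm (u - x)) * norm (u - y)"
    using small \<open>l0 > 0\<close> by (intro mult_right_mono) (simp_all add: field_simps)
  finally have "norm (u - y) \<le> (\<rho> * l0 * norm (u - x)) / l0"
    using \<open>l0 > 0\<close> \<open>\<rho> > 0\<close> by (intro coercive_form_norm_le[OF B0(3,4)]) auto
  then show ?thesis
    using \<open>l0 > 0\<close> by simp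
qed

lemma iterates_error_le:
  assumes B: "bilinear B" "bounded_form L B"
    and B0: "bilinear B0" "bounded_form L0 B0" "coercive_form l0 B0" "l0 > 0"
    and small: "form_norm (form_diff B B0) / l0 < \<rho>" and "\<rho> > 0"
    and u: "solves B f u"
    and U: "iterates B B0 f U"
  shows "norm (u - U n) \<le> norm u * \<rho> ^ (n + 1)"
proof (induction n)
  case 0
  \<comment> \<open>Thus \<open>U 0\<close> is the step from \<open>x = 0\<close>, whose error is
    \<open>u\<close> itself. This extra contraction gives the exponent \<open>n + 1\<close> rather
    than \<open>n\<close>.\<close>
  have "form_diff B B0 0 v = 0" for v
    by (rule bilinear_lzero[OF bilinear_form_diff[OF B(1) B0(1)]])
  then have "norm (u - U 0) \<le> \<rho> * norm (u - 0)"
    using U by (intro iterates_step_contraction[OF B B0 small \<open>\<rho> > 0\<close> u]) (simp add: iterates_def)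
  then show ?case by (simp add: mult.commute)
next
  case (Suc n)
  have "B0 (U (Suc n)) v = blinfun_apply f v - form_diff B B0 (U n) v" for v
    using U unfolding iterates_def by (metis diff_Suc_1 le_add1 plus_1_eq_Suc)
  then have "norm (u - U (Suc n)) \<le> \<rho> * norm (u - U n)"
    by (rule iterates_step_contraction[OF B B0 small \<open>\<rho> > 0\<close> u])
  also have "\<dots> \<le> \<rho> * (norm u * \<rho> ^ (n + 1))"
    using Suc \<open>\<rho> > 0\<close> by (intro mult_left_mono) auto
  finally show ?case by (simp add: mult_ac)
qed

theorem theorem3p1:
  fixes \<iota> :: "'v::banach \<Rightarrow> 'h::{real_inner, complete_space}"
    and \<Omega> :: "'w set"
    and F :: "'w \<Rightarrow> ('v \<Rightarrow>\<^sub>L real)"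
    and A :: "'w \<Rightarrow> 'v \<Rightarrow> 'v \<Rightarrow> real"
    and A\<^sub>0 :: "'v \<Rightarrow> 'v \<Rightarrow> real"
    and \<Lambda> \<alpha> C\<^sub>F \<Lambda>\<^sub>0 \<alpha>\<^sub>0 \<rho> :: real
    and u :: "'w \<Rightarrow> 'v"
    and U :: "'w \<Rightarrow> nat \<Rightarrow> 'v"
  assumes "linear \<iota>" and "inj \<iota>"
    and "\<Lambda> > 0" and "\<alpha> > 0" and "C\<^sub>F > 0"
    and "\<And>\<omega>. \<omega> \<in> \<Omega> \<Longrightarrow> bilinear (A \<omega>)"
    and "\<And>\<omega>. \<omega> \<in> \<Omega> \<Longrightarrow> bounded_form \<Lambda> (A \<omega>)"
    and "\<And>\<omega>. \<omega> \<in> \<Omega> \<Longrightarrow> coercive_form \<alpha> (A \<omega>)"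
    and "\<And>\<omega>. \<omega> \<in> \<Omega> \<Longrightarrow> norm (F \<omega>) \<le> C\<^sub>F"
    and "\<Lambda>\<^sub>0 > 0" and "\<alpha>\<^sub>0 > 0"
    and "bilinear A\<^sub>0" and "bounded_form \<Lambda>\<^sub>0 A\<^sub>0" and "coercive_form \<alpha>\<^sub>0 A\<^sub>0"
    and "0 < \<rho>" and "\<rho> < 1"
    and "\<And>\<omega>. \<omega> \<in> \<Omega> \<Longrightarrow> form_norm (form_diff (A \<omega>) A\<^sub>0) / \<alpha>\<^sub>0 < \<rho>"
    and "\<And>\<omega>. \<omega> \<in> \<Omega> \<Longrightarrow> solves (A \<omega>) (F \<omega>) (u \<omega>)"
    and "\<And>\<omega>. \<omega> \<in> \<Omega> \<Longrightarrow> iterates (A \<omega>) A\<^sub>0 (F \<omega>) (U \<omega>)"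
  shows "(\<exists>C>0. \<forall>\<omega>\<in>\<Omega>. \<forall>n. norm (u \<omega> - U \<omega> n) \<le> C * \<rho> ^ (n + 1)) \<and>
         (\<forall>\<omega>\<in>\<Omega>. U \<omega> \<longlonglongrightarrow> u \<omega>)"
proof -
  \<comment> \<open>The witness \<open>C\<^sub>F / \<alpha>\<close> is the bound on
    \<open>norm (u \<omega>)\<close> that is uniform over \<open>\<Omega>\<close>.\<close>
  have err: "norm (u \<omega> - U \<omega> n) \<le> (C\<^sub>F / \<alpha>) * \<rho> ^ (n + 1)" if "\<omega> \<in> \<Omega>" for \<omega> n
  proof -
    have "norm (u \<omega> - U \<omega> n) \<le> norm (u \<omega>) * \<rho> ^ (n + 1)"
      by (rule iterates_error_le[OF assms(6,7)[OF that] assms(12-14,11) assms(17)[OF that] assms(15)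
          assms(18,19)[OF that]])
    moreover have "norm (u \<omega>) \<le> norm (F \<omega>) / \<alpha>"
      by (rule solves_norm_le[OF assms(8)[OF that] assms(4) assms(18)[OF that]])
    moreover have "norm (F \<omega>) / \<alpha> \<le> C\<^sub>F / \<alpha>"
      using assms(9)[OF that] \<open>\<alpha> > 0\<close> by (simp add: divide_right_mono)
    ultimately show ?thesis
      using \<open>0 < \<rho>\<close> by (meson mult_right_mono order_trans zero_le_power less_imp_le)
  qed
  have "U \<omega> \<longlonglongrightarrow> u \<omega>" if "\<omega> \<in> \<Omega>" for \<omega>
  proof -
    have "(\<lambda>n. \<rho> ^ (n + 1)) \<longlonglongrightarrow> 0"
      using \<open>0 < \<rho>\<close> \<open>\<rho> < 1\<close> by (intro LIMSEQ_ignore_initial_segment LIMSEQ_realpow_zero) auto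
    then have "(\<lambda>n. (C\<^sub>F / \<alpha>) * \<rho> ^ (n + 1)) \<longlonglongrightarrow> 0"
      by (rule tendsto_mult_right_zero)
    then have "(\<lambda>n. U \<omega> n - u \<omega>) \<longlonglongrightarrow> 0"
      by (rule Lim_null_comparison[rotated])
        (use err[OF that] in \<open>simp add: norm_minus_commute\<close>)
    then show ?thesis
      by (rule LIM_zero_cancel)
  qed
  moreover have "C\<^sub>F / \<alpha> > 0"
    using \<open>C\<^sub>F > 0\<close> \<open>\<alpha> > 0\<close> by simp
  ultimately show ?thesis
    using err by blast
qed

end
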